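(* (1) The umbral algebra is the free Baxter algebra of weight zero on $C$. (2) Let $\{p_n(x)\}_{n\in\mathbb{N}}$ be a sequence of polynomials in $C[x]$. Then $\{p_n(x)\}_n$ is of binomial type if and only if it is the dual basis of a divided power pseudo-basis of the umbral algebra $U_0C=\mathcal{F}$.
   Context: $C$ is the base ring (commutative with identity) and $\mathbb{N}$ is the set of non-negative integers. Umbral algebra: $\mathcal{F}=\prod_{n\in\mathbb{N}}Ct_n$ is the direct product of rank one free $C$-modules, with componentwise addition and scalar multiplication and with multiplication given by $t_mt_n=\binom{m+n}{m}t_{m+n}$ for $m,n\in\mathbb{N}$; $t_0$ is the identity. The $C$-algebra $\mathcal{F}$ together with the basis $\{t_n\}$ is called the umbral algebra. For $\lambda\in C$, $U_\lambda C=\prod_{n\in\mathbb{N}}Cu_n$ is the $C$-algebra with product $u_mu_n=\sum_{k=0}^m\binom{m+n-k}{n}\binom{n}{k}\lambda^ku_{m+n-k}$, with the operator $P_C:u_n\mapsto u_{n+1}$; for $\lambda=0$ this is $\mathcal{F}$ with $u_n=t_n$ and operator $t_n\mapsto t_{n+1}$. $\mathcal{F}$ is identified with the dual $C$-module of $C[x]$ by taking $\{t_n\}$ to be the dual basis of $\{x^n\}$, that is, $t_k:C[x]\to C$, $x^n\mapsto\delta_{k,n}$. "Dual basis" in (2) refers to this duality: $f_m$ applied to $p_n(x)$ is $\delta_{m,n}$. A pseudo-basis of $\mathcal{F}$ is a sequence $\{f_n\}_{n\ge0}$ that is linearly independent and generates $\mathcal{F}$ as a topological $C$-module, where the topology is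 defined by the filtration $F^n=\{\sum_k c_kt_k\mid c_k=0 \text{ for } k\le n\}$. It is a divided power pseudo-basis if $f_mf_n=\binom{m+n}{m}f_{m+n}$ for all $m,n\ge0$. A sequence $\{p_n(x)\mid n\in\mathbb{N}\}$ of polynomials in $C[x]$ is of binomial type if $p_n(x+y)=\sum_{k=0}^n\binom{n}{k}p_{n-k}(x)p_k(y)$ for all $y\in C$ and $n\in\mathbb{N}$. A Baxter $C$-algebra of weight $\lambda\in C$ is a pair $(R,P)$ where $R$ is a $C$-algebra and $P:R\to R$ is a $C$-linear operator with $P(a)P(b)=P(aP(b))+P(bP(a))+\lambda P(ab)$ for all $a,b\in R$. Morphisms of Baxter algebras are $C$-algebra morphisms commuting with the operators. A free Baxter algebra of weight $\lambda$ on a $C$-algebra $A$ is a weight $\lambda$ Baxter algebra $(F_A,P_A)$ together with a $C$-algebra morphism $j_A:A\to F_A$ such that, for any weight $\lambda$ Baxter algebra $(R,P)$ and any $C$-algebra morphism $f:A\to R$, there is a unique weight $\lambda$ Baxter algebra morphism $\tilde f:(F_A,P_A)\to(R,P)$ with $\tilde f\circ j_A=f$.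
   Formalization: (1) F is shown free among complete Baxter algebras; the finite sums ⊕Ct_n are free among all. (2) "Binomial type ⇒ dual basis" assumes {p_n} is a basis of C[x], with the identity in C[x,y], or for y in C when polynomials over C are determined by their values. *)

theory Defs
  imports "HOL-Analysis.Elementary_Topology" "HOL-Computational_Algebra.Polynomial"
    "HOL-Computational_Algebra.Formal_Power_Series"
begin

section \<open>Baxter algebras\<close>

text \<open>Unital associative algebras over a commutative ring; commutativity is not required.\<close>

locale unital_algebra = module sc
  for sc :: "'c::comm_ring_1 \<Rightarrow> 'r::ring_1 \<Rightarrow> 'r" +
  assumes scale_mult_left: "sc c (x * y) = sc c x * y"
    and scale_mult_right: "sc c (x * y) = x * sc c y"

definition algebra_hom ::
  "('c::comm_ring_1 \<Rightarrow> 'r::ring_1 \<Rightarrow> 'r) \<Rightarrow> ('c \<Rightarrow> 's::ring_1 \<Rightarrow> 's) \<Rightarrow> ('r \<Rightarrow> 's) \<Rightarrow> bool"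
  where "algebra_hom s1 s2 \<phi> \<longleftrightarrow>
    module_hom s1 s2 \<phi> \<and> \<phi> 1 = 1 \<and> (\<forall>x y. \<phi> (x * y) = \<phi> x * \<phi> y)"

definition baxter_algebra ::
  "'c::comm_ring_1 \<Rightarrow> ('c \<Rightarrow> 'r::ring_1 \<Rightarrow> 'r) \<Rightarrow> ('r \<Rightarrow> 'r) \<Rightarrow> bool"
  where "baxter_algebra w sc P \<longleftrightarrow>
    unital_algebra sc \<and> module_hom sc sc P \<and>
    (\<forall>a b. P a * P b = P (a * P b) + P (b * P a) + sc w (P (a * b)))"

definition baxter_hom ::
  "('c::comm_ring_1 \<Rightarrow> 'r::ring_1 \<Rightarrow> 'r) \<Rightarrow> ('r \<Rightarrow> 'r) \<Rightarrow>
   ('c \<Rightarrow> 's::ring_1 \<Rightarrow> 's) \<Rightarrow> ('s \<Rightarrow> 's) \<Rightarrow> ('r \<Rightarrow> 's) \<Rightarrow> bool"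
  where "baxter_hom s1 P s2 Q \<phi> \<longleftrightarrow> algebra_hom s1 s2 \<phi> \<and> (\<forall>x. \<phi> (P x) = Q (\<phi> x))"

text \<open>
  The universal property quantifies over all Baxter algebras on the type \<open>'r\<close>; a theorem
  about \<open>TYPE('r)\<close> with \<open>'r\<close> a type variable is a statement about all of them.
\<close>

definition free_baxter_algebra ::
  "'r::ring_1 itself \<Rightarrow> 'c::comm_ring_1 \<Rightarrow> ('c \<Rightarrow> 'a::ring_1 \<Rightarrow> 'a) \<Rightarrow>
   ('c \<Rightarrow> 'f::ring_1 \<Rightarrow> 'f) \<Rightarrow> ('f \<Rightarrow> 'f) \<Rightarrow> ('a \<Rightarrow> 'f) \<Rightarrow> bool"
  where "free_baxter_algebra _ w scA scF P j \<longleftrightarrow>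
    unital_algebra scA \<and> baxter_algebra w scF P \<and> algebra_hom scA scF j \<and>
    (\<forall>(scR :: 'c \<Rightarrow> 'r \<Rightarrow> 'r) Q f.
       baxter_algebra w scR Q \<and> algebra_hom scA scR f \<longrightarrow>
       (\<exists>!\<phi>. baxter_hom scF P scR Q \<phi> \<and> \<phi> \<circ> j = f))"

text \<open>
  A Baxter algebra \<open>(R, P)\<close> carries the decreasing filtration whose \<open>n\<close>-th term is the Baxter
  ideal (two-sided ideal stable under \<open>P\<close>) generated by \<open>P\<^sup>n(R)\<close>, and every Baxter algebra
  morphism respects these filtrations.  \<open>(R, P)\<close> is complete if the canonical map from \<open>R\<close> to the
  inverse limit of the quotients \<open>R / Fil\<^sup>n R\<close> is bijective.  An element of the inverse limit is
  represented below by a sequence \<open>s\<close> with \<open>s (n + 1)\<close> congruent to \<open>s n\<close> modulo \<open>Fil\<^sup>n R\<close>.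
\<close>

definition baxter_ideal :: "('r::ring_1 \<Rightarrow> 'r) \<Rightarrow> 'r set \<Rightarrow> bool"
  where "baxter_ideal P I \<longleftrightarrow>
    0 \<in> I \<and> (\<forall>x\<in>I. \<forall>y\<in>I. x + y \<in> I) \<and> (\<forall>x\<in>I. \<forall>r. r * x \<in> I \<and> x * r \<in> I) \<and>
    (\<forall>x\<in>I. P x \<in> I)"

definition baxter_filtration :: "('r::ring_1 \<Rightarrow> 'r) \<Rightarrow> nat \<Rightarrow> 'r set"
  where "baxter_filtration P n = \<Inter>{I. baxter_ideal P I \<and> range (P ^^ n) \<subseteq> I}"

definition complete_baxter :: "('r::ring_1 \<Rightarrow> 'r) \<Rightarrow> bool"
  where "complete_baxter P \<longleftrightarrow>
    (\<Inter>n. baxter_filtration P n) = {0} \<and>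
    (\<forall>s. (\<forall>n. s (Suc n) - s n \<in> baxter_filtration P n) \<longrightarrow>
         (\<exists>l. \<forall>n. l - s n \<in> baxter_filtration P n))"

text \<open>Free objects in the full subcategory of complete Baxter algebras.\<close>

definition free_complete_baxter_algebra ::
  "'r::ring_1 itself \<Rightarrow> 'c::comm_ring_1 \<Rightarrow> ('c \<Rightarrow> 'a::ring_1 \<Rightarrow> 'a) \<Rightarrow>
   ('c \<Rightarrow> 'f::ring_1 \<Rightarrow> 'f) \<Rightarrow> ('f \<Rightarrow> 'f) \<Rightarrow> ('a \<Rightarrow> 'f) \<Rightarrow> bool"
  where "free_complete_baxter_algebra _ w scA scF P j \<longleftrightarrow>
    unital_algebra scA \<and> baxter_algebra w scF P \<and> complete_baxter P \<and>
    algebra_hom scA scF j \<and>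
    (\<forall>(scR :: 'c \<Rightarrow> 'r \<Rightarrow> 'r) Q f.
       baxter_algebra w scR Q \<and> complete_baxter Q \<and> algebra_hom scA scR f \<longrightarrow>
       (\<exists>!\<phi>. baxter_hom scF P scR Q \<phi> \<and> \<phi> \<circ> j = f))"


section \<open>The umbral algebra\<close>

text \<open>
  The element with coefficients \<open>c\<close> is the possibly infinite sum of the \<open>c k t\<^sub>k\<close>.
\<close>

typedef 'c umbral = "UNIV :: (nat \<Rightarrow> 'c) set"
  morphisms ucoeff Abs_umbral ..

setup_lifting type_definition_umbral

lemma umbral_eqI: "(\<And>n. ucoeff f n = ucoeff g n) \<Longrightarrow> f = g"
  by (simp add: ucoeff_inject[symmetric] fun_eq_iff)

instantiation umbral :: (comm_ring_1) comm_ring_1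
begin

lift_definition zero_umbral :: "'a umbral" is "\<lambda>_. 0" .
lift_definition one_umbral :: "'a umbral" is "\<lambda>n. if n = 0 then 1 else 0" .
lift_definition plus_umbral :: "'a umbral \<Rightarrow> 'a umbral \<Rightarrow> 'a umbral" is "\<lambda>f g n. f n + g n" .
lift_definition minus_umbral :: "'a umbral \<Rightarrow> 'a umbral \<Rightarrow> 'a umbral" is "\<lambda>f g n. f n - g n" .
lift_definition uminus_umbral :: "'a umbral \<Rightarrow> 'a umbral" is "\<lambda>f n. - f n" .
lift_definition times_umbral :: "'a umbral \<Rightarrow> 'a umbral \<Rightarrow> 'a umbral"
  is "\<lambda>f g n. \<Sum>k=0..n. of_nat (n choose k) * f k * g (n - k)" .

instance
proof
  fix f g h :: "'a umbral"
  show "f * g * h = f * (g * h)"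
  proof (rule umbral_eqI)
    fix n
    let ?T = "\<lambda>i j l. of_nat ((n choose (i + j)) * ((i + j) choose i))
                * (ucoeff f i * ucoeff g j * ucoeff h l)"
    have "ucoeff (f * g * h) n = (\<Sum>j=0..n. \<Sum>i=0..j. ?T i (j - i) (n - j))"
      by (simp add: times_umbral.rep_eq sum_distrib_left sum_distrib_right mult_ac)
    also have "\<dots> = (\<Sum>j=0..n. \<Sum>i=0..n - j. ?T j i (n - j - i))"
      using fps_mult_assoc_lemma[of ?T n n] .
    also have "\<dots> = (\<Sum>j=0..n. \<Sum>i=0..n - j. of_nat ((n choose j) * ((n - j) choose i))
              * (ucoeff f j * ucoeff g i * ucoeff h (n - j - i)))"
    proof (intro sum.cong refl)
      fix j i assume "j \<in> {0..n}" "i \<in> {0..n - j}"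
      then have "(n choose (j + i)) * ((j + i) choose j) = (n choose j) * ((n - j) choose i)"
        using choose_mult[of j "j + i" n] by simp
      then show "?T j i (n - j - i) = of_nat ((n choose j) * ((n - j) choose i))
              * (ucoeff f j * ucoeff g i * ucoeff h (n - j - i))"
        by (simp only:)
    qed
    also have "\<dots> = ucoeff (f * (g * h)) n"
      by (simp add: times_umbral.rep_eq sum_distrib_left mult_ac)
    finally show "ucoeff (f * g * h) n = ucoeff (f * (g * h)) n" .
  qed
  show "f * g = g * f"
  proof (rule umbral_eqI)
    fix n
    have "ucoeff (f * g) n
        = (\<Sum>k=0..n. of_nat (n choose (n - k)) * ucoeff f (n - k) * ucoeff g (n - (n - k)))"
      unfolding times_umbral.rep_eq by (rule sum.reindex_bij_witness[of _ "\<lambda>k. n - k" "\<lambda>k. n - k"]) auto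
    also have "\<dots> = ucoeff (g * f) n"
      unfolding times_umbral.rep_eq
    proof (intro sum.cong refl)
      fix k assume "k \<in> {0..n}"
      then have k: "k \<le> n" by simp
      show "of_nat (n choose (n - k)) * ucoeff f (n - k) * ucoeff g (n - (n - k))
          = of_nat (n choose k) * ucoeff g k * ucoeff f (n - k)"
        unfolding binomial_symmetric[OF k] diff_diff_cancel[OF k] by (simp only: mult_ac)
    qed
    finally show "ucoeff (f * g) n = ucoeff (g * f) n" .
  qed
  show "1 * f = f"
  proof (rule umbral_eqI)
    fix n
    have "ucoeff (1 * f) n = (\<Sum>k=0..n. if k = 0 then ucoeff f n else 0)"
      unfolding times_umbral.rep_eq one_umbral.rep_eq by (intro sum.cong) auto
    then show "ucoeff (1 * f) n = ucoeff f n" by simp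
  qed
  show "(f + g) * h = f * h + g * h"
    by (rule umbral_eqI)
      (simp add: times_umbral.rep_eq plus_umbral.rep_eq algebra_simps sum.distrib)
  show "f + g + h = f + (g + h)" "f + g = g + f" "0 + f = f" "- f + f = 0" "f - g = f + - g"
    by (transfer; simp add: fun_eq_iff)+
  show "(0 :: 'a umbral) \<noteq> 1"
    by transfer (metis zero_neq_one)
qed

end

lift_definition umbral_scale :: "'c::comm_ring_1 \<Rightarrow> 'c umbral \<Rightarrow> 'c umbral" is "\<lambda>c f n. c * f n" .
lift_definition umbral_t :: "nat \<Rightarrow> 'c::comm_ring_1 umbral" is "\<lambda>n k. if k = n then 1 else 0" .

text \<open>The operator \<open>t\<^sub>n \<mapsto> t\<^sub>n\<^sub>+\<^sub>1\<close>, extended to infinite sums.\<close>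

lift_definition umbral_shift :: "'c::comm_ring_1 umbral \<Rightarrow> 'c umbral"
  is "\<lambda>f n. if n = 0 then 0 else f (n - 1)" .

definition umbral_const :: "'c::comm_ring_1 \<Rightarrow> 'c umbral"
  where "umbral_const c = umbral_scale c 1"

lemma umbral_t_0: "umbral_t 0 = 1"
  by transfer auto

lemma umbral_t_mult:
  "umbral_t m * umbral_t n = umbral_scale (of_nat ((m + n) choose m)) (umbral_t (m + n))"
proof (rule umbral_eqI)
  fix k
  have "ucoeff (umbral_t m * umbral_t n :: 'a umbral) k
      = (\<Sum>i=0..k. if i = m then (if k - m = n then of_nat (k choose m) else 0) else 0)"
    unfolding times_umbral.rep_eq umbral_t.rep_eq by (intro sum.cong) auto
  also have "\<dots> = ucoeff (umbral_scale (of_nat ((m + n) choose m)) (umbral_t (m + n) :: 'a umbral)) k"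
    by (auto simp: umbral_scale.rep_eq umbral_t.rep_eq)
  finally show "ucoeff (umbral_t m * umbral_t n :: 'a umbral) k = \<dots>" .
qed

lemma umbral_shift_t: "umbral_shift (umbral_t n) = umbral_t (Suc n)"
  by transfer (auto simp: fun_eq_iff)


subsection \<open>The subalgebra of finite sums\<close>

text \<open>
  The full direct product satisfies the universal property only against complete Baxter
  algebras.  Against all Baxter algebras it is satisfied by the dense Baxter subalgebra of
  finite sums, the direct sum of the \<open>C t\<^sub>n\<close>.
\<close>

typedef (overloaded) 'c fin_umbral = "{f :: 'c::comm_ring_1 umbral. finite {n. ucoeff f n \<noteq> 0}}"
  morphisms of_fin_umbral Abs_fin_umbral
  by (rule exI[of _ 0]) (simp add: zero_umbral.rep_eq)

setup_lifting type_definition_fin_umbral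

instantiation fin_umbral :: (comm_ring_1) comm_ring_1
begin

lift_definition zero_fin_umbral :: "'a fin_umbral" is 0
  by (simp add: zero_umbral.rep_eq)
lift_definition one_fin_umbral :: "'a fin_umbral" is 1
  by (simp add: one_umbral.rep_eq)
lift_definition plus_fin_umbral :: "'a fin_umbral \<Rightarrow> 'a fin_umbral \<Rightarrow> 'a fin_umbral" is "(+)"
proof -
  fix f g :: "'a umbral"
  assume "finite {n. ucoeff f n \<noteq> 0}" "finite {n. ucoeff g n \<noteq> 0}"
  then have "finite ({n. ucoeff f n \<noteq> 0} \<union> {n. ucoeff g n \<noteq> 0})" by simp
  then show "finite {n. ucoeff (f + g) n \<noteq> 0}"
    by (rule rev_finite_subset) (auto simp: plus_umbral.rep_eq)
qed
lift_definition minus_fin_umbral :: "'a fin_umbral \<Rightarrow> 'a fin_umbral \<Rightarrow> 'a fin_umbral" is "(-)"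
proof -
  fix f g :: "'a umbral"
  assume "finite {n. ucoeff f n \<noteq> 0}" "finite {n. ucoeff g n \<noteq> 0}"
  then have "finite ({n. ucoeff f n \<noteq> 0} \<union> {n. ucoeff g n \<noteq> 0})" by simp
  then show "finite {n. ucoeff (f - g) n \<noteq> 0}"
    by (rule rev_finite_subset) (auto simp: minus_umbral.rep_eq)
qed
lift_definition uminus_fin_umbral :: "'a fin_umbral \<Rightarrow> 'a fin_umbral" is "uminus"
  by (simp add: uminus_umbral.rep_eq)
lift_definition times_fin_umbral :: "'a fin_umbral \<Rightarrow> 'a fin_umbral \<Rightarrow> 'a fin_umbral" is "(*)"
proof -
  fix f g :: "'a umbral"
  assume fin: "finite {n. ucoeff f n \<noteq> 0}" "finite {n. ucoeff g n \<noteq> 0}"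
  have "{n. ucoeff (f * g) n \<noteq> 0} \<subseteq> (\<lambda>(i, j). i + j) ` ({n. ucoeff f n \<noteq> 0} \<times> {n. ucoeff g n \<noteq> 0})"
  proof
    fix n assume "n \<in> {n. ucoeff (f * g) n \<noteq> 0}"
    then have "(\<Sum>k=0..n. of_nat (n choose k) * ucoeff f k * ucoeff g (n - k)) \<noteq> 0"
      by (simp add: times_umbral.rep_eq)
    then obtain k where "k \<in> {0..n}" "of_nat (n choose k) * ucoeff f k * ucoeff g (n - k) \<noteq> 0"
      by (rule sum.not_neutral_contains_not_neutral)
    then have "k \<le> n" by simp
    have "ucoeff f k \<noteq> 0" "ucoeff g (n - k) \<noteq> 0"
      using \<open>of_nat (n choose k) * ucoeff f k * ucoeff g (n - k) \<noteq> 0\<close> by auto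
    with \<open>k \<le> n\<close> show "n \<in> (\<lambda>(i, j). i + j) ` ({n. ucoeff f n \<noteq> 0} \<times> {n. ucoeff g n \<noteq> 0})"
      by (intro image_eqI[of _ _ "(k, n - k)"]) auto
  qed
  then show "finite {n. ucoeff (f * g) n \<noteq> 0}"
    by (rule finite_subset) (use fin in auto)
qed

instance
proof
  fix f g h :: "'a fin_umbral"
  show "f * g * h = f * (g * h)" by transfer (rule mult.assoc)
  show "f * g = g * f" by transfer (rule mult.commute)
  show "1 * f = f" by transfer simp
  show "(f + g) * h = f * h + g * h" by transfer (rule distrib_right)
  show "f + g + h = f + (g + h)" by transfer (rule add.assoc)
  show "f + g = g + f" by transfer (rule add.commute)
  show "0 + f = f" "- f + f = 0" "f - g = f + - g" by (transfer; simp)+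
  show "(0 :: 'a fin_umbral) \<noteq> 1" by transfer simp
qed

end

lift_definition fin_umbral_scale :: "'c::comm_ring_1 \<Rightarrow> 'c fin_umbral \<Rightarrow> 'c fin_umbral"
  is umbral_scale
  by (erule rev_finite_subset) (auto simp: umbral_scale.rep_eq)

lift_definition fin_umbral_shift :: "'c::comm_ring_1 fin_umbral \<Rightarrow> 'c fin_umbral"
  is umbral_shift
proof -
  fix f :: "'c umbral" assume "finite {n. ucoeff f n \<noteq> 0}"
  then have "finite (Suc ` {n. ucoeff f n \<noteq> 0})" by simp
  then show "finite {n. ucoeff (umbral_shift f) n \<noteq> 0}"
  proof (rule rev_finite_subset, intro subsetI)
    fix n assume "n \<in> {n. ucoeff (umbral_shift f) n \<noteq> 0}"
    then show "n \<in> Suc ` {n. ucoeff f n \<noteq> 0}"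
      by (cases n) (auto simp: umbral_shift.rep_eq)
  qed
qed

definition fin_umbral_const :: "'c::comm_ring_1 \<Rightarrow> 'c fin_umbral"
  where "fin_umbral_const c = fin_umbral_scale c 1"


section \<open>Pseudo-bases and duality with polynomials\<close>

definition umbral_fil :: "nat \<Rightarrow> 'c::comm_ring_1 umbral set"
  where "umbral_fil n = {f. \<forall>k\<le>n. ucoeff f k = 0}"

instantiation umbral :: (comm_ring_1) topological_space
begin

definition open_umbral :: "'a umbral set \<Rightarrow> bool"
  where "open_umbral U \<longleftrightarrow> (\<forall>f\<in>U. \<exists>n. \<forall>g. g - f \<in> umbral_fil n \<longrightarrow> g \<in> U)"

instance
proof
  show "open (UNIV :: 'a umbral set)" by (simp add: open_umbral_def)
next
  fix S T :: "'a umbral set" assume S: "open S" and T: "open T"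
  show "open (S \<inter> T)" unfolding open_umbral_def
  proof
    fix f assume "f \<in> S \<inter> T"
    then have "f \<in> S" "f \<in> T" by simp_all
    obtain m where m: "g \<in> S" if "g - f \<in> umbral_fil m" for g
      using S \<open>f \<in> S\<close> unfolding open_umbral_def by meson
    obtain n where n: "g \<in> T" if "g - f \<in> umbral_fil n" for g
      using T \<open>f \<in> T\<close> unfolding open_umbral_def by meson
    show "\<exists>n. \<forall>g. g - f \<in> umbral_fil n \<longrightarrow> g \<in> S \<inter> T"
    proof (intro exI allI impI IntI)
      fix g assume "g - f \<in> umbral_fil (max m n)"
      then show "g \<in> S" "g \<in> T"
        by (auto simp: umbral_fil_def intro: m n)
    qed
  qed
next
  fix K :: "'a umbral set set" assume K: "\<forall>S\<in>K. open S"
  show "open (\<Union>K)" unfolding open_umbral_def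
  proof
    fix f assume "f \<in> \<Union>K"
    then obtain S where S: "S \<in> K" "f \<in> S" by auto
    with K obtain n where "g \<in> S" if "g - f \<in> umbral_fil n" for g
      unfolding open_umbral_def by meson
    with S show "\<exists>n. \<forall>g. g - f \<in> umbral_fil n \<longrightarrow> g \<in> \<Union>K"
      by auto
  qed
qed

end

definition pseudo_basis :: "(nat \<Rightarrow> 'c::comm_ring_1 umbral) \<Rightarrow> bool"
  where "pseudo_basis f \<longleftrightarrow>
    inj f \<and> \<not> module.dependent umbral_scale (range f) \<and>
    closure (module.span umbral_scale (range f)) = UNIV"

definition divided_power_pseudo_basis :: "(nat \<Rightarrow> 'c::comm_ring_1 umbral) \<Rightarrow> bool"
  where "divided_power_pseudo_basis f \<longleftrightarrow> pseudo_basis f \<and>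
    (\<forall>m n. f m * f n = umbral_scale (of_nat ((m + n) choose m)) (f (m + n)))"

text \<open>The identification of the umbral algebra with the dual module of \<open>C[x]\<close>.\<close>

definition umbral_apply :: "'c::comm_ring_1 umbral \<Rightarrow> 'c poly \<Rightarrow> 'c"
  where "umbral_apply f q = (\<Sum>k\<le>degree q. ucoeff f k * coeff q k)"

lemma umbral_apply_t_monom: "umbral_apply (umbral_t k) (monom 1 n) = (if k = n then 1 else 0)"
proof -
  have "umbral_apply (umbral_t k) (monom (1::'a) n)
      = (\<Sum>i\<le>n. if i = n then (if i = k then 1 else 0) else 0)"
    unfolding umbral_apply_def by (intro sum.cong) (auto simp: umbral_t.rep_eq degree_monom_eq)
  then show ?thesis by simp
qed

definition dual_sequence :: "(nat \<Rightarrow> 'c::comm_ring_1 umbral) \<Rightarrow> (nat \<Rightarrow> 'c poly) \<Rightarrow> bool"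
  where "dual_sequence f p \<longleftrightarrow> (\<forall>m n. umbral_apply (f m) (p n) = (if m = n then 1 else 0))"

definition dual_of_divided_power_pseudo_basis :: "(nat \<Rightarrow> 'c::comm_ring_1 poly) \<Rightarrow> bool"
  where "dual_of_divided_power_pseudo_basis p \<longleftrightarrow>
    (\<exists>f. divided_power_pseudo_basis f \<and> dual_sequence f p)"

definition polynomial_basis :: "(nat \<Rightarrow> 'c::comm_ring_1 poly) \<Rightarrow> bool"
  where "polynomial_basis p \<longleftrightarrow>
    inj p \<and> \<not> module.dependent smult (range p) \<and> module.span smult (range p) = UNIV"


section \<open>Sequences of binomial type\<close>

text \<open>The identity holds in \<open>C[x]\<close> for every value \<open>y\<close> in \<open>C\<close>.\<close>

definition binomial_type :: "(nat \<Rightarrow> 'c::comm_ring_1 poly) \<Rightarrow> bool"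
  where "binomial_type p \<longleftrightarrow>
    (\<forall>y n. pcompose (p n) [:y, 1:] =
       (\<Sum>k\<le>n. smult (of_nat (n choose k) * poly (p k) y) (p (n - k))))"

text \<open>
  The same identity in \<open>C[x, y]\<close>, realised as \<open>C[y][x]\<close>.  It implies the version above, but over
  a finite ring the two differ: over the field with two elements, take the sequence \<open>p\<close> given by
  \<open>p 0 = 1\<close> and \<open>p n = x\<^sup>n + x\<^sup>2 + x\<close> for positive \<open>n\<close>.
\<close>

definition in_x :: "'c::comm_ring_1 poly \<Rightarrow> 'c poly poly"
  where "in_x q = map_poly (\<lambda>c. [:c:]) q"

definition in_y :: "'c::comm_ring_1 poly \<Rightarrow> 'c poly poly"
  where "in_y q = [:q:]"

definition formal_binomial_type :: "(nat \<Rightarrow> 'c::comm_ring_1 poly) \<Rightarrow> bool"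
  where "formal_binomial_type p \<longleftrightarrow>
    (\<forall>n. pcompose (in_x (p n)) [:[:0, 1:], 1:] =
       (\<Sum>k\<le>n. of_nat (n choose k) * in_x (p (n - k)) * in_y (p k)))"

text \<open>Holds for every infinite integral domain, and fails for every finite ring.\<close>

definition polynomials_are_functions :: "'c::comm_ring_1 itself \<Rightarrow> bool"
  where "polynomials_are_functions _ \<longleftrightarrow> (\<forall>q :: 'c poly. (\<forall>y. poly q y = 0) \<longrightarrow> q = 0)"

end

theory Submission
  imports Defs
begin

text \<open>
  In a Baxter algebra of weight zero, \<open>P\<^sup>m(1) P\<^sup>n(1)\<close> is the binomial coefficient
  \<open>m + n\<close> over \<open>m\<close> times \<open>P\<^sup>m\<^sup>+\<^sup>n(1)\<close>, so \<open>t\<^sub>n \<mapsto> P\<^sup>n(1)\<close> is forced and multiplicative; it extends to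
  infinite sums by completeness, the products of two truncations at \<open>n\<close> differing from the
  truncated product only by terms \<open>P\<^sup>k(1)\<close> with \<open>k \<ge> n\<close>.

  The product of the umbral algebra is dual to the coproduct \<open>x \<mapsto> x + y\<close> of \<open>C[x]\<close>.  Hence \<open>p\<close> is
  of binomial type if and only if \<open>(f g)(p\<^sub>n)\<close> is the binomial convolution of the values
  \<open>f(p\<^sub>i)\<close> and \<open>g(p\<^sub>j)\<close> for all functionals \<open>f\<close> and \<open>g\<close>.  On a dual sequence this is exactly the
  divided power rule, and it passes from a pseudo-basis to all functionals by density, since
  both sides depend on finitely many coefficients only.
\<close>

section \<open>Free Baxter algebras of weight zero\<close>

locale weight_zero_baxter = unital_algebra sc
  for sc :: "'c::comm_ring_1 \<Rightarrow> 'r::ring_1 \<Rightarrow> 'r" +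
  fixes Q :: "'r \<Rightarrow> 'r"
  assumes hom_Q: "module_hom sc sc Q"
    and baxter: "Q a * Q b = Q (a * Q b) + Q (b * Q a)"
begin

sublocale Q: module_hom sc sc Q
  by (rule hom_Q)

lemma scale_mult_scale: "sc a x * sc b y = sc (a * b) (x * y)"
  by (simp flip: scale_mult_left scale_mult_right add: mult.commute)

text \<open>The Baxter identity turns the product into two products of total exponent one less, and
  Pascal's rule adds their coefficients.\<close>

lemma pow_one_mult_pow_one:
  "(Q ^^ m) 1 * (Q ^^ n) 1 = sc (of_nat ((m + n) choose m)) ((Q ^^ (m + n)) 1)"
proof (induction "m + n" arbitrary: m n rule: less_induct)
  case less
  show ?case
  proof (cases "m = 0 \<or> n = 0")
    case False
    then obtain i j where ij: "m = Suc i" "n = Suc j"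
      by (meson not0_implies_Suc)
    have "(Q ^^ m) 1 * (Q ^^ n) 1 = Q ((Q ^^ i) 1 * (Q ^^ n) 1) + Q ((Q ^^ j) 1 * (Q ^^ m) 1)"
      using baxter[of "(Q ^^ i) 1" "(Q ^^ j) 1"] by (simp add: ij)
    also have "(Q ^^ i) 1 * (Q ^^ n) 1 = sc (of_nat ((i + n) choose i)) ((Q ^^ (i + n)) 1)"
      by (rule less) (simp add: ij)
    also have "(Q ^^ j) 1 * (Q ^^ m) 1 = sc (of_nat ((j + m) choose j)) ((Q ^^ (j + m)) 1)"
      by (rule less) (simp add: ij)
    \<comment> \<open>Symmetry makes this the neighbour of \<open>(i + n) choose i\<close> in
      Pascal's rule.\<close>
    also have "(j + m) choose j = (i + n) choose Suc i"
      using binomial_symmetric[of j "j + m"] by (simp add: ij add.commute)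
    also have "j + m = i + n" by (simp add: ij)
    finally show ?thesis
      by (simp add: ij Q.scale scale_left_distrib[symmetric])
  qed auto
qed

text \<open>The image of a truncation to indices below \<open>n\<close> under
  \<open>t_k \<mapsto> (Q ^^ k) 1\<close>. With coefficients given as a function, one definition
  serves infinite and finite umbral elements alike.\<close>

definition psum :: "(nat \<Rightarrow> 'c) \<Rightarrow> nat \<Rightarrow> 'r"
  where "psum c n = (\<Sum>k<n. sc (c k) ((Q ^^ k) 1))"

lemma psum_add: "psum (\<lambda>k. a k + b k) n = psum a n + psum b n"
  by (simp add: psum_def scale_left_distrib sum.distrib)

lemma psum_scale: "psum (\<lambda>k. c * a k) n = sc c (psum a n)"
  by (simp add: psum_def scale_sum_right)

lemma psum_one: "n > 0 \<Longrightarrow> psum (ucoeff 1) n = 1"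
proof -
  assume "n > 0"
  have "psum (ucoeff 1) n = (\<Sum>k<n. if k = 0 then 1 else 0)"
    unfolding psum_def by (intro sum.cong) (auto simp: one_umbral.rep_eq)
  with \<open>n > 0\<close> show ?thesis by simp
qed

lemma psum_shift: "psum (ucoeff (umbral_shift f)) (Suc n) = Q (psum (ucoeff f) n)"
  unfolding psum_def sum.lessThan_Suc_shift by (simp add: umbral_shift.rep_eq Q.sum Q.scale)

text \<open>The square of index pairs is split along \<open>i + j = n\<close>, and the lower
  triangle is the truncated product. The other terms involve only powers of \<open>Q\<close> from
  \<open>n\<close> on: the filtration absorbs them in the complete case, finite support kills them
  in the other.\<close>

lemma psum_mult:
  "psum (ucoeff f) n * psum (ucoeff g) n = psum (ucoeff (f * g)) n +
     (\<Sum>(i, j)\<in>{(i, j). i < n \<and> j < n \<and> n \<le> i + j}.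
        sc (of_nat ((i + j) choose i) * ucoeff f i * ucoeff g j) ((Q ^^ (i + j)) 1))"
proof -
  let ?T = "\<lambda>i j. sc (of_nat ((i + j) choose i) * ucoeff f i * ucoeff g j) ((Q ^^ (i + j)) 1)"
  let ?A = "{(i, j). i + j < n}" and ?B = "{(i, j). i < n \<and> j < n \<and> n \<le> i + j}"
  have fin: "finite ({..<n} \<times> {..<n})" by simp
  have split: "{..<n} \<times> {..<n} = ?A \<union> ?B" by auto
  have "psum (ucoeff f) n * psum (ucoeff g) n = (\<Sum>(i, j)\<in>{..<n} \<times> {..<n}. ?T i j)"
    by (simp add: psum_def sum_product sum.cartesian_product scale_mult_scale
        pow_one_mult_pow_one mult_ac)
  also have "\<dots> = (\<Sum>(i, j)\<in>?A. ?T i j) + (\<Sum>(i, j)\<in>?B. ?T i j)"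
    unfolding split using fin by (intro sum.union_disjoint) (auto simp: split)
  also have "(\<Sum>(i, j)\<in>?A. ?T i j) = psum (ucoeff (f * g)) n"
    by (simp add: sum.triangle_reindex psum_def times_umbral.rep_eq scale_sum_left atMost_atLeast0)
  finally show ?thesis .
qed

section \<open>The Baxter filtration\<close>

lemma baxter_ideal_filtration: "baxter_ideal Q (baxter_filtration Q n)"
  unfolding baxter_filtration_def baxter_ideal_def by auto

lemma filtration_add: "x \<in> baxter_filtration Q n \<Longrightarrow> y \<in> baxter_filtration Q n \<Longrightarrow> x + y \<in> baxter_filtration Q n"
  and filtration_zero: "0 \<in> baxter_filtration Q n"
  and filtration_mult_left: "x \<in> baxter_filtration Q n \<Longrightarrow> r * x \<in> baxter_filtration Q n"
  and filtration_mult_right: "x \<in> baxter_filtration Q n \<Longrightarrow> x * r \<in> baxter_filtration Q n"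
  and filtration_Q: "x \<in> baxter_filtration Q n \<Longrightarrow> Q x \<in> baxter_filtration Q n"
  using baxter_ideal_filtration[of n] unfolding baxter_ideal_def by blast+

text \<open>\<open>baxter_ideal\<close> mentions neither negation nor scalars; both are
  multiplications by ring elements, \<open>- 1\<close> and \<open>sc c 1\<close>.\<close>

lemma filtration_minus: "x \<in> baxter_filtration Q n \<Longrightarrow> - x \<in> baxter_filtration Q n"
  using filtration_mult_left[of x n "- 1"] by simp

lemma filtration_diff:
  "x \<in> baxter_filtration Q n \<Longrightarrow> y \<in> baxter_filtration Q n \<Longrightarrow> x - y \<in> baxter_filtration Q n"
  using filtration_add[of x n "- y"] filtration_minus[of y n] by simp

lemma filtration_scale: "x \<in> baxter_filtration Q n \<Longrightarrow> sc c x \<in> baxter_filtration Q n"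
  using filtration_mult_left[of x n "sc c 1"] by (simp flip: scale_mult_left)

lemma filtration_sum:
  "(\<And>i. i \<in> A \<Longrightarrow> h i \<in> baxter_filtration Q n) \<Longrightarrow> sum h A \<in> baxter_filtration Q n"
  by (induction A rule: infinite_finite_induct) (auto intro: filtration_zero filtration_add)

lemma pow_in_filtration: "n \<le> k \<Longrightarrow> (Q ^^ k) x \<in> baxter_filtration Q n"
proof -
  assume "n \<le> k"
  then have "(Q ^^ k) x = (Q ^^ n) ((Q ^^ (k - n)) x)"
    by (metis comp_apply funpow_add le_add_diff_inverse)
  then show ?thesis unfolding baxter_filtration_def by auto
qed

text \<open>This is the Cauchy condition of \<open>complete_baxter\<close> for the sequence of
  truncations.\<close>

lemma psum_step: "psum c (Suc n) - psum c n \<in> baxter_filtration Q n"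
  by (simp add: psum_def filtration_scale pow_in_filtration)

lemma psum_mult_mod_filtration:
  "psum (ucoeff f) n * psum (ucoeff g) n - psum (ucoeff (f * g)) n \<in> baxter_filtration Q n"
  unfolding psum_mult
  by (auto intro!: filtration_sum filtration_scale pow_in_filtration)

end

text \<open>The weight term \<open>sc 0 _\<close> disappears only through the module laws, so each
  direction first interprets the algebra.\<close>

lemma baxter_algebra_zero_iff: "baxter_algebra 0 sc Q \<longleftrightarrow> weight_zero_baxter sc Q"
proof
  assume *: "baxter_algebra 0 sc Q"
  then interpret unital_algebra sc by (simp add: baxter_algebra_def)
  show "weight_zero_baxter sc Q"
    using * unital_algebra_axioms
    by (simp add: baxter_algebra_def weight_zero_baxter_def weight_zero_baxter_axioms_def)
next
  assume "weight_zero_baxter sc Q"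
  then interpret weight_zero_baxter sc Q .
  show "baxter_algebra 0 sc Q"
    by (simp add: baxter_algebra_def unital_algebra_axioms hom_Q baxter)
qed

section \<open>The umbral algebra as a complete Baxter algebra\<close>

lemma unital_algebra_self: "unital_algebra ((*) :: 'c::comm_ring_1 \<Rightarrow> 'c \<Rightarrow> 'c)"
  by unfold_locales (simp_all add: algebra_simps)

lemma umbral_scale_mult_left: "umbral_scale c (f * g) = umbral_scale c f * g"
  by (rule umbral_eqI)
    (simp add: umbral_scale.rep_eq times_umbral.rep_eq sum_distrib_left mult.assoc mult.left_commute)

lemma unital_algebra_umbral: "unital_algebra (umbral_scale :: 'c::comm_ring_1 \<Rightarrow> _)"
proof unfold_locales
  fix a b :: 'c and f g :: "'c umbral"
  show "umbral_scale a (f + g) = umbral_scale a f + umbral_scale a g"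
    "umbral_scale (a + b) f = umbral_scale a f + umbral_scale b f"
    by (rule umbral_eqI, simp add: umbral_scale.rep_eq plus_umbral.rep_eq algebra_simps)+
  show "umbral_scale a (umbral_scale b f) = umbral_scale (a * b) f" "umbral_scale 1 f = f"
    by (rule umbral_eqI, simp add: umbral_scale.rep_eq mult_ac)+
  show "umbral_scale a (f * g) = umbral_scale a f * g"
    by (rule umbral_scale_mult_left)
  show "umbral_scale a (f * g) = f * umbral_scale a g"
    using umbral_scale_mult_left[of a g f] by (simp add: mult.commute)
qed

text \<open>Coefficientwise this is Pascal's rule for \<open>Suc m choose Suc k\<close>, once both
  terms on the right are sums over the same products.\<close>

lemma umbral_shift_mult:
  "umbral_shift f * umbral_shift g = umbral_shift (f * umbral_shift g) + umbral_shift (g * umbral_shift f)"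
proof (rule umbral_eqI)
  fix n
  show "ucoeff (umbral_shift f * umbral_shift g) n =
      ucoeff (umbral_shift (f * umbral_shift g) + umbral_shift (g * umbral_shift f)) n"
  proof (cases n)
    case 0
    then show ?thesis by (simp add: times_umbral.rep_eq plus_umbral.rep_eq umbral_shift.rep_eq)
  next
    case (Suc m)
    have 1: "ucoeff (f * umbral_shift g) m =
        (\<Sum>k=0..m. of_nat (m choose k) * ucoeff f k * ucoeff (umbral_shift g) (m - k))"
      by (simp only: times_umbral.rep_eq)
    have 2: "ucoeff (g * umbral_shift f) m =
        (\<Sum>k=0..m. of_nat (m choose Suc k) * ucoeff f k * ucoeff (umbral_shift g) (m - k))"
    proof -
      have "ucoeff (g * umbral_shift f) m = ucoeff (umbral_shift f * g) m"
        by (simp add: mult.commute)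
      \<comment> \<open>The added term \<open>k = Suc m\<close> is zero because
        \<open>m choose Suc m\<close> is. Shifting \<open>g\<close> as well makes the products match
        those of the first sum after reindexing.\<close>
      also have "\<dots> = (\<Sum>k=0..Suc m. of_nat (m choose k) * ucoeff (umbral_shift f) k * ucoeff (umbral_shift g) (Suc m - k))"
        by (simp add: times_umbral.rep_eq umbral_shift.rep_eq)
      also have "\<dots> = (\<Sum>k=0..m. of_nat (m choose Suc k) * ucoeff f k * ucoeff (umbral_shift g) (m - k))"
        unfolding sum.atLeast0_atMost_Suc_shift diff_Suc_Suc comp_def by (simp add: umbral_shift.rep_eq)
      finally show ?thesis .
    qed
    have "ucoeff (umbral_shift f * umbral_shift g) (Suc m) =
        (\<Sum>k=0..m. of_nat (Suc m choose Suc k) * ucoeff f k * ucoeff (umbral_shift g) (m - k))"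
      unfolding times_umbral.rep_eq sum.atLeast0_atMost_Suc_shift diff_Suc_Suc comp_def by (simp add: umbral_shift.rep_eq)
    also have "\<dots> = ucoeff (f * umbral_shift g) m + ucoeff (g * umbral_shift f) m"
      by (simp add: 1 2 sum.distrib algebra_simps)
    finally show ?thesis
      by (simp add: Suc plus_umbral.rep_eq umbral_shift.rep_eq)
  qed
qed

lemma umbral_baxter: "weight_zero_baxter (umbral_scale :: 'c::comm_ring_1 \<Rightarrow> _) umbral_shift"
proof -
  interpret unital_algebra "umbral_scale :: 'c \<Rightarrow> _" by (rule unital_algebra_umbral)
  have "umbral_shift (f + g) = umbral_shift f + umbral_shift g"
    "umbral_shift (umbral_scale c f) = umbral_scale c (umbral_shift f)" for c :: 'c and f g
    by (rule umbral_eqI, simp add: umbral_shift.rep_eq plus_umbral.rep_eq umbral_scale.rep_eq)+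
  then show ?thesis
    by unfold_locales (simp_all add: umbral_shift_mult)
qed

lemma algebra_hom_umbral_const: "algebra_hom (*) umbral_scale (umbral_const :: 'c::comm_ring_1 \<Rightarrow> _)"
proof -
  interpret weight_zero_baxter "umbral_scale :: 'c \<Rightarrow> _" umbral_shift by (rule umbral_baxter)
  show ?thesis
    using module_hom_scale_left[of 1]
    by (auto simp: algebra_hom_def umbral_const_def[abs_def] scale_mult_scale)
qed

lemma ucoeff_shift_pow: "ucoeff ((umbral_shift ^^ n) f) k = (if k < n then 0 else ucoeff f (k - n))"
  by (induction n arbitrary: k) (auto simp: umbral_shift.rep_eq)

text \<open>\<open>?F\<close> is a Baxter ideal and equals the range of the \<open>n\<close>-th
  power of the shift. The bound is \<open>k < n\<close>, whereas \<open>umbral_fil n\<close> has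
  \<open>k \<le> n\<close>.\<close>

lemma baxter_filtration_umbral:
  "baxter_filtration (umbral_shift :: 'c::comm_ring_1 umbral \<Rightarrow> _) n = {f. \<forall>k<n. ucoeff f k = 0}"
  (is "_ = ?F")
proof
  have "x * y \<in> ?F" if "x \<in> ?F" for x y :: "'c umbral"
    using that by (auto simp: times_umbral.rep_eq intro!: sum.neutral)
  then have "baxter_ideal umbral_shift ?F"
    unfolding baxter_ideal_def
    by (auto simp: zero_umbral.rep_eq plus_umbral.rep_eq umbral_shift.rep_eq mult.commute)
  then show "baxter_filtration umbral_shift n \<subseteq> ?F"
    unfolding baxter_filtration_def by (auto simp: ucoeff_shift_pow)
  interpret weight_zero_baxter "umbral_scale :: 'c \<Rightarrow> _" umbral_shift by (rule umbral_baxter)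
  show "?F \<subseteq> baxter_filtration umbral_shift n"
  proof
    fix f assume "f \<in> ?F"
    then have "f = (umbral_shift ^^ n) (Abs_umbral (\<lambda>k. ucoeff f (k + n)))"
      by (intro umbral_eqI) (simp add: ucoeff_shift_pow Abs_umbral_inverse)
    then show "f \<in> baxter_filtration umbral_shift n"
      by (metis pow_in_filtration order_refl)
  qed
qed

lemma complete_baxter_umbral: "complete_baxter (umbral_shift :: 'c::comm_ring_1 umbral \<Rightarrow> _)"
  unfolding complete_baxter_def baxter_filtration_umbral
proof (intro conjI allI impI)
  show "(\<Inter>n. {f :: 'c umbral. \<forall>k<n. ucoeff f k = 0}) = {0}"
    by (auto simp: zero_umbral.rep_eq intro!: umbral_eqI) (meson lessI)
next
  fix s :: "nat \<Rightarrow> 'c umbral"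
  assume s: "\<forall>n. s (Suc n) - s n \<in> {f. \<forall>k<n. ucoeff f k = 0}"
  have eq: "ucoeff (s (n + d)) k = ucoeff (s n) k" if "k < n" for n d k
    using that s by (induction d) (auto simp: minus_umbral.rep_eq)
  \<comment> \<open>Coefficient \<open>k\<close> is constant from \<open>s (Suc k)\<close> on, so
    the diagonal of these values is the limit.\<close>
  have "ucoeff (s (Suc k)) k = ucoeff (s n) k" if "k < n" for k n
    using eq[of k "Suc k" "n - Suc k"] that by simp
  then show "\<exists>l. \<forall>n. l - s n \<in> {f. \<forall>k<n. ucoeff f k = 0}"
    by (intro exI[of _ "Abs_umbral (\<lambda>k. ucoeff (s (Suc k)) k)"])
      (simp add: minus_umbral.rep_eq Abs_umbral_inverse)
qed

text \<open>The tail lies in the image of the \<open>n\<close>-th power of the operator, so a Baxter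
  morphism carries it into the \<open>n\<close>-th filtration term.\<close>

lemma umbral_expansion:
  "f = weight_zero_baxter.psum umbral_scale umbral_shift (ucoeff f) n
       + (umbral_shift ^^ n) (Abs_umbral (\<lambda>k. ucoeff f (k + n)))"
proof -
  interpret weight_zero_baxter "umbral_scale :: 'a \<Rightarrow> _" umbral_shift by (rule umbral_baxter)
  have *: "ucoeff (sum h A) k = (\<Sum>i\<in>A. ucoeff (h i) k)" for h :: "nat \<Rightarrow> 'a umbral" and A k
    by (induction A rule: infinite_finite_induct) (auto simp: zero_umbral.rep_eq plus_umbral.rep_eq)
  have pow: "(umbral_shift ^^ i) 1 = umbral_t i" for i
    by (induction i) (auto simp: umbral_t_0 umbral_shift_t)
  show ?thesis
    by (rule umbral_eqI)
      (simp add: psum_def * pow plus_umbral.rep_eq umbral_scale.rep_eq umbral_t.rep_eq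
        ucoeff_shift_pow Abs_umbral_inverse if_distrib[of "\<lambda>x. _ * x"] cong: if_cong)
qed

lemma free_complete_baxter_algebra_umbral:
  "free_complete_baxter_algebra TYPE('r::ring_1) (0 :: 'c::comm_ring_1) (*)
     umbral_scale umbral_shift umbral_const"
  unfolding free_complete_baxter_algebra_def baxter_algebra_zero_iff
proof (intro conjI allI impI)
  show "unital_algebra ((*) :: 'c \<Rightarrow> _)" by (rule unital_algebra_self)
  show "weight_zero_baxter (umbral_scale :: 'c \<Rightarrow> _) umbral_shift" by (rule umbral_baxter)
  show "complete_baxter (umbral_shift :: 'c umbral \<Rightarrow> _)" by (rule complete_baxter_umbral)
  show "algebra_hom (*) umbral_scale (umbral_const :: 'c \<Rightarrow> _)" by (rule algebra_hom_umbral_const)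
next
  fix scR :: "'c \<Rightarrow> 'r \<Rightarrow> 'r" and Q f
  assume "weight_zero_baxter scR Q \<and> complete_baxter Q \<and> algebra_hom (*) scR f"
  then have "weight_zero_baxter scR Q" and complete: "complete_baxter Q"
    and f: "algebra_hom (*) scR f" by simp_all
  then interpret weight_zero_baxter scR Q by simp
  interpret U: weight_zero_baxter "umbral_scale :: 'c \<Rightarrow> _" umbral_shift by (rule umbral_baxter)
  \<comment> \<open>A morphism out of the base ring is determined by
    \<open>1 \<mapsto> 1\<close>.\<close>
  have f_eq: "f c = scR c 1" for c
  proof -
    interpret f: module_hom "(*)" scR f using f by (simp add: algebra_hom_def)
    have "f (c * 1) = scR c (f 1)" by (rule f.scale)
    then show ?thesis using f by (simp add: algebra_hom_def)
  qed
  let ?F = "baxter_filtration Q"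
  have separated: "x = y" if "\<And>n. x - y \<in> ?F n" for x y
  proof -
    have "x - y \<in> (\<Inter>n. ?F n)" using that by simp
    also have "(\<Inter>n. ?F n) = {0}" using complete by (simp only: complete_baxter_def)
    finally show ?thesis by simp
  qed
  \<comment> \<open>The value at \<open>g\<close> is to be the limit of the truncations.\<close>
  have "\<exists>l. \<forall>n. l - psum (ucoeff g) n \<in> ?F n" for g
    using complete psum_step unfolding complete_baxter_def by blast
  then obtain \<phi> where \<phi>: "\<phi> g - psum (ucoeff g) n \<in> ?F n" for g n
    by metis
  \<comment> \<open>Limits are unique, so each identity for \<open>\<phi>\<close> reduces to a
    congruence modulo every filtration term.\<close>
  have \<phi>_eqI: "\<phi> g = x" if "\<And>n. x - psum (ucoeff g) n \<in> ?F n" for g x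
  proof (rule separated)
    fix n
    have "(\<phi> g - psum (ucoeff g) n) - (x - psum (ucoeff g) n) \<in> ?F n"
      by (rule filtration_diff[OF \<phi> that])
    then show "\<phi> g - x \<in> ?F n" by simp
  qed
  have \<phi>_add: "\<phi> (g + h) = \<phi> g + \<phi> h" for g h
    by (rule \<phi>_eqI) (use filtration_add[OF \<phi> \<phi>] in \<open>simp add: plus_umbral.rep_eq psum_add algebra_simps\<close>)
  have \<phi>_scale: "\<phi> (umbral_scale c g) = scR c (\<phi> g)" for c g
    by (rule \<phi>_eqI) (use filtration_scale[OF \<phi>, of c g] in
        \<open>simp add: umbral_scale.rep_eq psum_scale scale_right_diff_distrib\<close>)
  have \<phi>_one: "\<phi> 1 = 1"
  proof (rule \<phi>_eqI)
    fix n show "1 - psum (ucoeff 1) n \<in> ?F n"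
      \<comment> \<open>At \<open>n = 0\<close> the truncation is empty, but then the filtration
        term is the whole ring.\<close>
      by (cases "n = 0") (use pow_in_filtration[of 0 0] in \<open>simp_all add: psum_one filtration_zero\<close>)
  qed
  have \<phi>_mult: "\<phi> (g * h) = \<phi> g * \<phi> h" for g h
  proof (rule \<phi>_eqI)
    fix n
    let ?g = "psum (ucoeff g) n" and ?h = "psum (ucoeff h) n"
    have "(\<phi> g - ?g) * \<phi> h + ?g * (\<phi> h - ?h) + (?g * ?h - psum (ucoeff (g * h)) n) \<in> ?F n"
      by (intro filtration_add filtration_mult_left filtration_mult_right \<phi> psum_mult_mod_filtration)
    then show "\<phi> g * \<phi> h - psum (ucoeff (g * h)) n \<in> ?F n"
      by (simp add: algebra_simps)
  qed
  have \<phi>_shift: "\<phi> (umbral_shift g) = Q (\<phi> g)" for g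
  proof (rule \<phi>_eqI)
    fix n
    let ?p = "psum (ucoeff (umbral_shift g))"
    \<comment> \<open>\<open>psum_shift\<close> relates truncations at \<open>n\<close> and
      \<open>Suc n\<close>; the step between them lies in the filtration.\<close>
    have "Q (\<phi> g - psum (ucoeff g) n) + (?p (Suc n) - ?p n) \<in> ?F n"
      by (intro filtration_add filtration_Q \<phi> psum_step)
    then show "Q (\<phi> g) - ?p n \<in> ?F n"
      by (simp add: Q.diff psum_shift)
  qed
  have "module_hom umbral_scale scR \<phi>"
    by unfold_locales (rule \<phi>_add \<phi>_scale)+
  then have hom: "baxter_hom umbral_scale umbral_shift scR Q \<phi>"
    by (simp add: baxter_hom_def algebra_hom_def \<phi>_one \<phi>_mult \<phi>_shift)
  have "\<phi> \<circ> umbral_const = f"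
    by (simp add: fun_eq_iff umbral_const_def \<phi>_scale \<phi>_one f_eq)
  moreover have "\<psi> = \<phi>" if "baxter_hom umbral_scale umbral_shift scR Q \<psi>" for \<psi>
  proof
    fix g
    interpret \<psi>: module_hom umbral_scale scR \<psi>
      using that by (simp add: baxter_hom_def algebra_hom_def)
    have pow: "\<psi> ((umbral_shift ^^ n) x) = (Q ^^ n) (\<psi> x)" for n x
      using that by (induction n) (auto simp: baxter_hom_def)
    have one: "\<psi> 1 = 1" using that by (simp add: baxter_hom_def algebra_hom_def)
    \<comment> \<open>Truncations go to truncations, and the tail of \<open>umbral_expansion\<close>
      goes into the filtration.\<close>
    have "\<psi> g - psum (ucoeff g) n \<in> ?F n" for n
    proof -
      have "\<psi> (U.psum (ucoeff g) n) = psum (ucoeff g) n"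
        by (simp add: U.psum_def psum_def \<psi>.sum \<psi>.scale pow one)
      then show ?thesis
        by (subst umbral_expansion[of g n]) (simp add: \<psi>.add pow pow_in_filtration)
    qed
    then show "\<psi> g = \<phi> g" using \<phi>_eqI by metis
  qed
  ultimately show "\<exists>!\<phi>. baxter_hom umbral_scale umbral_shift scR Q \<phi> \<and> \<phi> \<circ> umbral_const = f"
    using hom by blast
qed

section \<open>Finite sums against arbitrary Baxter algebras\<close>

lemma fin_umbral_baxter: "weight_zero_baxter (fin_umbral_scale :: 'c::comm_ring_1 \<Rightarrow> _) fin_umbral_shift"
proof -
  interpret U: weight_zero_baxter "umbral_scale :: 'c \<Rightarrow> _" umbral_shift by (rule umbral_baxter)
  note rep = of_fin_umbral_inject[symmetric] fin_umbral_scale.rep_eq fin_umbral_shift.rep_eq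
    plus_fin_umbral.rep_eq times_fin_umbral.rep_eq
  show ?thesis
    by unfold_locales
      (simp_all add: rep U.scale_right_distrib U.scale_left_distrib U.Q.add U.Q.scale
        U.scale_mult_left[symmetric] U.scale_mult_right[symmetric] U.baxter)
qed

lemma algebra_hom_fin_umbral_const:
  "algebra_hom (*) fin_umbral_scale (fin_umbral_const :: 'c::comm_ring_1 \<Rightarrow> _)"
proof -
  interpret weight_zero_baxter "fin_umbral_scale :: 'c \<Rightarrow> _" fin_umbral_shift
    by (rule fin_umbral_baxter)
  show ?thesis
    using module_hom_scale_left[of 1]
    by (auto simp: algebra_hom_def fin_umbral_const_def[abs_def] scale_mult_scale)
qed

text \<open>This is \<open>umbral_expansion\<close> with zero tail, transported along the
  embedding.\<close>

lemma fin_umbral_expansion: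
  fixes g :: "'c::comm_ring_1 fin_umbral"
  assumes "\<And>k. n \<le> k \<Longrightarrow> ucoeff (of_fin_umbral g) k = 0"
  shows "g = weight_zero_baxter.psum fin_umbral_scale fin_umbral_shift (ucoeff (of_fin_umbral g)) n"
proof -
  interpret U: weight_zero_baxter "umbral_scale :: 'c \<Rightarrow> _" umbral_shift by (rule umbral_baxter)
  interpret weight_zero_baxter "fin_umbral_scale :: 'c \<Rightarrow> _" fin_umbral_shift
    by (rule fin_umbral_baxter)
  have pow: "of_fin_umbral ((fin_umbral_shift ^^ k) x) = (umbral_shift ^^ k) (of_fin_umbral x)" for k x
    by (induction k) (auto simp: fin_umbral_shift.rep_eq)
  have sum: "of_fin_umbral (sum h A) = (\<Sum>i\<in>A. of_fin_umbral (h i))" for h :: "nat \<Rightarrow> 'c fin_umbral" and A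
    by (induction A rule: infinite_finite_induct)
      (auto simp: zero_fin_umbral.rep_eq plus_fin_umbral.rep_eq)
  have "of_fin_umbral (psum (ucoeff (of_fin_umbral g)) n) = U.psum (ucoeff (of_fin_umbral g)) n"
    by (simp add: psum_def U.psum_def sum pow fin_umbral_scale.rep_eq one_fin_umbral.rep_eq)
  also have "\<dots> = of_fin_umbral g"
    by (subst (2) umbral_expansion[of _ n])
      (rule umbral_eqI, simp add: plus_umbral.rep_eq ucoeff_shift_pow Abs_umbral_inverse assms)
  finally show ?thesis by (simp add: of_fin_umbral_inject)
qed

lemma free_baxter_algebra_fin_umbral:
  "free_baxter_algebra TYPE('r::ring_1) (0 :: 'c::comm_ring_1) (*)
     fin_umbral_scale fin_umbral_shift fin_umbral_const"
  unfolding free_baxter_algebra_def baxter_algebra_zero_iff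
proof (intro conjI allI impI)
  show "unital_algebra ((*) :: 'c \<Rightarrow> _)" by (rule unital_algebra_self)
  show "weight_zero_baxter (fin_umbral_scale :: 'c \<Rightarrow> _) fin_umbral_shift"
    by (rule fin_umbral_baxter)
  show "algebra_hom (*) fin_umbral_scale (fin_umbral_const :: 'c \<Rightarrow> _)"
    by (rule algebra_hom_fin_umbral_const)
next
  fix scR :: "'c \<Rightarrow> 'r \<Rightarrow> 'r" and Q f
  assume "weight_zero_baxter scR Q \<and> algebra_hom (*) scR f"
  then have "weight_zero_baxter scR Q" and f: "algebra_hom (*) scR f" by simp_all
  then interpret weight_zero_baxter scR Q by simp
  interpret U: weight_zero_baxter "fin_umbral_scale :: 'c \<Rightarrow> _" fin_umbral_shift
    by (rule fin_umbral_baxter)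
  have f_eq: "f c = scR c 1" for c
  proof -
    interpret f: module_hom "(*)" scR f using f by (simp add: algebra_hom_def)
    have "f (c * 1) = scR c (f 1)" by (rule f.scale)
    then show ?thesis using f by (simp add: algebra_hom_def)
  qed
  define coef where "coef g = ucoeff (of_fin_umbral g)" for g :: "'c fin_umbral"
  have "\<exists>n. \<forall>k\<ge>n. coef g k = 0" for g
  proof -
    have "finite {k. coef g k \<noteq> 0}" using of_fin_umbral[of g] by (simp add: coef_def)
    then show ?thesis
      by (metis (mono_tags, lifting) finite_nat_set_iff_bounded leD mem_Collect_eq)
  qed
  then obtain N where N: "\<And>g k. N g \<le> k \<Longrightarrow> coef g k = 0" by metis
  define \<phi> where "\<phi> g = psum (coef g) (N g)" for g
  \<comment> \<open>\<open>N g\<close> is some bound of the support. Larger truncations give the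
    same value, so identities can be compared at one common \<open>n\<close>.\<close>
  have \<phi>: "\<phi> g = psum (coef g) n" if "N g \<le> n" for g n
    unfolding \<phi>_def psum_def using that N by (intro sum.mono_neutral_left) auto
  have \<phi>_add: "\<phi> (g + h) = \<phi> g + \<phi> h" for g h
  proof -
    define n where "n = N g + N h + N (g + h)"
    show ?thesis
      by (simp add: \<phi>[of _ n] n_def coef_def plus_fin_umbral.rep_eq plus_umbral.rep_eq psum_add)
  qed
  have \<phi>_scale: "\<phi> (fin_umbral_scale c g) = scR c (\<phi> g)" for c g
  proof -
    define n where "n = N g + N (fin_umbral_scale c g)"
    show ?thesis
      by (simp add: \<phi>[of _ n] n_def coef_def fin_umbral_scale.rep_eq umbral_scale.rep_eq psum_scale)
  qed
  have \<phi>_one: "\<phi> 1 = 1"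
    by (simp add: \<phi>[of _ "Suc (N 1)"] coef_def one_fin_umbral.rep_eq psum_one)
  have \<phi>_mult: "\<phi> (g * h) = \<phi> g * \<phi> h" for g h
  proof -
    define n where "n = N g + N h + N (g * h)"
    \<comment> \<open>If \<open>i + j\<close> reaches \<open>n\<close>, one index is past the
      support of its factor, so the error term of \<open>psum_mult\<close> vanishes.\<close>
    have "coef g i * coef h j = 0" if "n \<le> i + j" for i j
      using N[of g i] N[of h j] that by (cases "N g \<le> i") (auto simp: n_def)
    then have "psum (coef g) n * psum (coef h) n = psum (coef (g * h)) n"
      unfolding coef_def times_fin_umbral.rep_eq psum_mult
      by (auto intro!: sum.neutral simp: mult.assoc)
    then show ?thesis by (simp add: \<phi>[of _ n] n_def)
  qed
  have \<phi>_shift: "\<phi> (fin_umbral_shift g) = Q (\<phi> g)" for g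
  proof -
    define n where "n = N g + N (fin_umbral_shift g)"
    have "\<phi> (fin_umbral_shift g) = psum (coef (fin_umbral_shift g)) (Suc n)"
      by (rule \<phi>) (simp add: n_def)
    also have "\<dots> = Q (psum (coef g) n)"
      by (simp add: coef_def fin_umbral_shift.rep_eq psum_shift)
    finally show ?thesis by (simp add: \<phi>[of g n] n_def)
  qed
  have "module_hom fin_umbral_scale scR \<phi>"
    by unfold_locales (rule \<phi>_add \<phi>_scale)+
  then have hom: "baxter_hom fin_umbral_scale fin_umbral_shift scR Q \<phi>"
    by (simp add: baxter_hom_def algebra_hom_def \<phi>_one \<phi>_mult \<phi>_shift)
  have "\<phi> \<circ> fin_umbral_const = f"
    by (simp add: fun_eq_iff fin_umbral_const_def \<phi>_scale \<phi>_one f_eq)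
  moreover have "\<psi> = \<phi>" if "baxter_hom fin_umbral_scale fin_umbral_shift scR Q \<psi>" for \<psi>
  proof
    fix g
    interpret \<psi>: module_hom fin_umbral_scale scR \<psi>
      using that by (simp add: baxter_hom_def algebra_hom_def)
    have pow: "\<psi> ((fin_umbral_shift ^^ n) 1) = (Q ^^ n) 1" for n
      using that by (induction n) (auto simp: baxter_hom_def algebra_hom_def)
    have "g = U.psum (coef g) (N g)"
      unfolding coef_def by (rule fin_umbral_expansion) (use N in \<open>simp add: coef_def\<close>)
    then have "\<psi> g = \<psi> (U.psum (coef g) (N g))" by simp
    also have "\<dots> = \<phi> g"
      by (simp add: \<phi>_def U.psum_def psum_def \<psi>.sum \<psi>.scale pow)
    finally show "\<psi> g = \<phi> g" .
  qed
  ultimately show "\<exists>!\<phi>. baxter_hom fin_umbral_scale fin_umbral_shift scR Q \<phi> \<and> \<phi> \<circ> fin_umbral_const = f"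
    using hom by blast
qed

interpretation umbral_algebra: unital_algebra "umbral_scale :: 'c::comm_ring_1 \<Rightarrow> _"
  by (rule unital_algebra_umbral)

section \<open>Umbral elements as linear functionals\<close>

lemma poly_monom_induct:
  assumes "\<And>c n. P (monom c n)" and "\<And>q r. P q \<Longrightarrow> P r \<Longrightarrow> P (q + r)"
  shows "P q"
proof -
  have "P (\<Sum>i\<in>A. monom (coeff q i) i)" if "finite A" for A
    using that by induction (use assms(1)[of 0 0] in \<open>simp_all add: assms\<close>)
  then show ?thesis by (metis poly_as_sum_of_monoms finite_atMost)
qed

text \<open>Degrees can drop under sums and scalings; linearity in the polynomial needs a common
  bound instead.\<close>

lemma umbral_apply_eq_sum:
  assumes "degree q \<le> n"
  shows "umbral_apply f q = (\<Sum>k\<le>n. ucoeff f k * coeff q k)"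
  unfolding umbral_apply_def
  by (rule sum.mono_neutral_left) (use assms in \<open>auto simp: coeff_eq_0\<close>)

lemma umbral_apply_add_right: "umbral_apply f (q + r) = umbral_apply f q + umbral_apply f r"
proof -
  let ?n = "max (degree q) (degree r)"
  have "degree (q + r) \<le> ?n" by (rule degree_add_le_max)
  then show ?thesis
    by (simp add: umbral_apply_eq_sum[of _ ?n] algebra_simps sum.distrib)
qed

lemma umbral_apply_zero_right [simp]: "umbral_apply f 0 = 0"
  by (simp add: umbral_apply_def)

lemma umbral_apply_smult: "umbral_apply f (smult c q) = c * umbral_apply f q"
  by (subst umbral_apply_eq_sum[OF degree_smult_le]) (simp add: umbral_apply_def sum_distrib_left mult_ac)

lemma umbral_apply_monom: "umbral_apply f (monom c n) = ucoeff f n * c"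
proof -
  have "umbral_apply f (monom c n) = (\<Sum>k\<le>n. if k = n then ucoeff f n * c else 0)"
    by (subst umbral_apply_eq_sum[OF degree_monom_le]) (intro sum.cong, auto)
  then show ?thesis by simp
qed

lemma umbral_apply_t: "umbral_apply (umbral_t i) q = coeff q i"
  by (induction q rule: poly_monom_induct)
    (auto simp: umbral_apply_add_right umbral_apply_monom umbral_t.rep_eq)

lemma module_self: "module ((*) :: 'c::comm_ring_1 \<Rightarrow> 'c \<Rightarrow> 'c)"
  by (rule unital_algebra.axioms(1)[OF unital_algebra_self])

lemma module_homI:
  assumes "module s1" "module s2" "\<And>x y. f (x + y) = f x + f y" "\<And>c x. f (s1 c x) = s2 c (f x)"
  shows "module_hom s1 s2 f"
  using assms by (simp add: module_hom_iff)

lemma module_hom_umbral_apply: "module_hom umbral_scale (*) (\<lambda>f. umbral_apply f q)"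
  by (intro module_homI module_self umbral_algebra.module_axioms)
    (simp_all add: umbral_apply_def plus_umbral.rep_eq umbral_scale.rep_eq distrib_right
      sum.distrib sum_distrib_left mult.assoc)

lemmas umbral_apply_add_left = module_hom.add[OF module_hom_umbral_apply]
  and umbral_apply_scale_left = module_hom.scale[OF module_hom_umbral_apply]
  and umbral_apply_sum_left = module_hom.sum[OF module_hom_umbral_apply]

lemma umbral_eq_apply_monomI:
  "(\<And>k. umbral_apply f (monom 1 k) = umbral_apply g (monom 1 k)) \<Longrightarrow> f = g"
  by (rule umbral_eqI) (simp add: umbral_apply_monom)

text \<open>Evaluation at \<open>y\<close> as an umbral element; it turns the pointwise binomial
  identity into one between functionals.\<close>

definition umbral_eval :: "'c::comm_ring_1 \<Rightarrow> 'c umbral"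
  where "umbral_eval y = Abs_umbral (\<lambda>n. y ^ n)"

lemma umbral_apply_eval: "umbral_apply (umbral_eval y) q = poly q y"
  by (simp add: umbral_eval_def umbral_apply_def Abs_umbral_inverse poly_altdef mult.commute)

text \<open>The functional \<open>f \<otimes> g\<close> on \<open>C[y][x]\<close>, with \<open>f\<close> acting on the outer variable \<open>x\<close>.\<close>

definition umbral_apply2 :: "'c::comm_ring_1 umbral \<Rightarrow> 'c umbral \<Rightarrow> 'c poly poly \<Rightarrow> 'c"
  where "umbral_apply2 f g D = umbral_apply f (map_poly (umbral_apply g) D)"

lemma umbral_apply2_zero [simp]: "umbral_apply2 f g 0 = 0"
  by (simp add: umbral_apply2_def)

lemma umbral_apply2_add: "umbral_apply2 f g (D + E) = umbral_apply2 f g D + umbral_apply2 f g E"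
proof -
  have "map_poly (umbral_apply g) (D + E) = map_poly (umbral_apply g) D + map_poly (umbral_apply g) E"
    by (rule poly_eqI) (simp add: coeff_map_poly umbral_apply_add_right)
  then show ?thesis by (simp add: umbral_apply2_def umbral_apply_add_right)
qed

lemma umbral_apply2_sum: "umbral_apply2 f g (sum D A) = (\<Sum>i\<in>A. umbral_apply2 f g (D i))"
  by (induction A rule: infinite_finite_induct) (simp_all add: umbral_apply2_add)

lemma umbral_apply2_of_nat: "umbral_apply2 f g (of_nat c * D) = of_nat c * umbral_apply2 f g D"
  by (induction c) (simp_all add: umbral_apply2_add distrib_right)

lemma umbral_apply2_product:
  "umbral_apply2 f g (in_x q * in_y r) = umbral_apply f q * umbral_apply g r"
proof -
  have "map_poly (umbral_apply g) (in_x q * in_y r) = smult (umbral_apply g r) q"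
    by (rule poly_eqI)
      (simp add: in_x_def in_y_def coeff_map_poly mult.commute[of _ r] umbral_apply_smult)
  then show ?thesis by (simp add: umbral_apply2_def umbral_apply_smult)
qed

text \<open>Together with \<open>umbral_apply_t\<close> this shows that pairs of
  \<open>umbral_t\<close> read off every coefficient and so separate \<open>C[y][x]\<close>.\<close>

lemma umbral_apply2_t: "umbral_apply2 (umbral_t i) g D = umbral_apply g (coeff D i)"
  by (simp add: umbral_apply2_def umbral_apply_t coeff_map_poly)

lemma pcompose_monom: "pcompose (monom c n) r = smult c (r ^ n)"
  by (simp add: pcompose_altdef map_poly_monom poly_monom)

text \<open>Multiplication in the umbral algebra is dual to the coproduct \<open>x \<mapsto> x + y\<close> on \<open>C[x]\<close>.\<close>

lemma umbral_apply2_translate: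
  "umbral_apply2 f g (pcompose (in_x q) [:[:0, 1:], 1:]) = umbral_apply (f * g) q"
proof (induction q rule: poly_monom_induct)
  case (1 c n)
  let ?D = "pcompose (in_x (monom c n)) [:[:0, 1:], 1:]"
  \<comment> \<open>The binomial theorem for \<open>(x + y)^n\<close>, ordered by powers of the
    outer variable.\<close>
  have coeff: "coeff ?D k = monom (of_nat (n choose k) * c) (n - k)" if "k \<le> n" for k
    using that by (simp add: in_x_def map_poly_monom pcompose_monom coeff_linear_poly_power
        mult.commute of_nat_poly smult_monom flip: monom_altdef)
  have "degree ?D \<le> n"
    unfolding in_x_def by (simp add: map_poly_monom pcompose_monom)
      (intro order.trans[OF degree_smult_le] order.trans[OF degree_power_le], simp)
  then have "degree (map_poly (umbral_apply g) ?D) \<le> n"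
    by (rule order.trans[OF map_poly_degree_leq])
  then have "umbral_apply2 f g ?D = (\<Sum>k\<le>n. ucoeff f k * umbral_apply g (coeff ?D k))"
    by (simp add: umbral_apply2_def umbral_apply_eq_sum coeff_map_poly)
  also have "\<dots> = (\<Sum>k\<le>n. ucoeff f k * (ucoeff g (n - k) * (of_nat (n choose k) * c)))"
    by (intro sum.cong refl) (simp add: coeff umbral_apply_monom)
  also have "\<dots> = (\<Sum>k\<le>n. of_nat (n choose k) * ucoeff f k * ucoeff g (n - k)) * c"
    by (simp add: sum_distrib_left mult_ac)
  also have "\<dots> = umbral_apply (f * g) (monom c n)"
    by (simp add: umbral_apply_monom times_umbral.rep_eq atMost_atLeast0)
  finally show ?case .
next
  case (2 q r)
  have "in_x (q + r) = in_x q + in_x r"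
    by (rule poly_eqI) (simp add: in_x_def coeff_map_poly)
  then show ?case
    by (simp add: 2 pcompose_add umbral_apply2_add umbral_apply_add_right)
qed

text \<open>The coproduct duality with the second functional an evaluation, so that the second
  variable becomes the scalar \<open>y\<close>.\<close>

lemma coeff_pcompose_translate:
  "coeff (pcompose q [:y, 1:]) i = umbral_apply (umbral_t i * umbral_eval y) q"
proof (induction q rule: poly_monom_induct)
  case (1 c n)
  have "ucoeff (umbral_t i * umbral_eval y) n
      = (\<Sum>k=0..n. if k = i then of_nat (n choose i) * y ^ (n - i) else 0)"
    unfolding times_umbral.rep_eq
    by (intro sum.cong) (auto simp: umbral_t.rep_eq umbral_eval_def Abs_umbral_inverse)
  \<comment> \<open>For \<open>i > n\<close> both sides are zero: no \<open>k \<le> n\<close> equals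
    \<open>i\<close>, and the degree is too small.\<close>
  moreover have "n < i \<Longrightarrow> degree ([:y, 1:] ^ n) < i"
    using degree_power_le[of "[:y, 1:]" n] by simp
  ultimately show ?case
    by (auto simp: pcompose_monom umbral_apply_monom coeff_linear_poly_power coeff_eq_0 mult_ac)
qed (simp add: pcompose_add umbral_apply_add_right)

text \<open>The binomial identity tested against \<open>f\<close> in \<open>x\<close> and
  \<open>g\<close> in \<open>y\<close>. The two notions of binomial type ask for it on different
  supplies of pairs.\<close>

definition binomial_on :: "(nat \<Rightarrow> 'c::comm_ring_1 poly) \<Rightarrow> 'c umbral \<Rightarrow> 'c umbral \<Rightarrow> bool"
  where "binomial_on p f g \<longleftrightarrow> (\<forall>n. umbral_apply (f * g) (p n) =
    (\<Sum>k\<le>n. of_nat (n choose k) * umbral_apply f (p (n - k)) * umbral_apply g (p k)))"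

lemma umbral_apply2_binomial:
  "umbral_apply2 f g (\<Sum>k\<le>n. of_nat (n choose k) * in_x (p (n - k)) * in_y (p k)) =
   (\<Sum>k\<le>n. of_nat (n choose k) * umbral_apply f (p (n - k)) * umbral_apply g (p k))"
  by (simp add: umbral_apply2_sum umbral_apply2_of_nat umbral_apply2_product mult.assoc)

lemma formal_binomial_type_iff: "formal_binomial_type p \<longleftrightarrow> (\<forall>f g. binomial_on p f g)"
proof
  assume "formal_binomial_type p"
  then show "\<forall>f g. binomial_on p f g"
    unfolding binomial_on_def formal_binomial_type_def
    by (simp flip: umbral_apply2_translate umbral_apply2_binomial)
next
  assume *: "\<forall>f g. binomial_on p f g"
  show "formal_binomial_type p"
    unfolding formal_binomial_type_def
  proof (intro allI poly_eqI)
    fix n i j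
    let ?L = "pcompose (in_x (p n)) [:[:0, 1:], 1:]"
    let ?R = "\<Sum>k\<le>n. of_nat (n choose k) * in_x (p (n - k)) * in_y (p k)"
    have "umbral_apply2 (umbral_t i) (umbral_t j) ?L = umbral_apply2 (umbral_t i) (umbral_t j) ?R"
      using * by (simp only: umbral_apply2_translate umbral_apply2_binomial binomial_on_def)
    then show "coeff (coeff ?L i) j = coeff (coeff ?R i) j"
      by (simp only: umbral_apply2_t umbral_apply_t)
  qed
qed

lemma binomial_type_iff:
  "binomial_type p \<longleftrightarrow> (\<forall>y i. binomial_on p (umbral_t i) (umbral_eval y))"
proof -
  have "coeff (\<Sum>k\<le>n. smult (of_nat (n choose k) * poly (p k) y) (p (n - k))) i =
      (\<Sum>k\<le>n. of_nat (n choose k) * coeff (p (n - k)) i * poly (p k) y)" for n y i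
    by (simp add: coeff_sum mult_ac)
  then show ?thesis
    unfolding binomial_type_def binomial_on_def poly_eq_iff coeff_pcompose_translate
      umbral_apply_t umbral_apply_eval
    by (simp only:) blast
qed

lemma binomial_type_if_formal: "formal_binomial_type p \<Longrightarrow> binomial_type p"
  by (simp add: formal_binomial_type_iff binomial_type_iff)

text \<open>For each power of \<open>x\<close>, its coefficients on the two sides are polynomials in
  \<open>y\<close> that agree at all points of the ring.\<close>

lemma formal_binomial_type_if_binomial_type:
  fixes p :: "nat \<Rightarrow> 'c::comm_ring_1 poly"
  assumes "polynomials_are_functions TYPE('c)" and "binomial_type p"
  shows "formal_binomial_type p"
  unfolding formal_binomial_type_def
proof (intro allI poly_eqI[of "_ :: 'c poly poly"])
  fix n i
  let ?L = "pcompose (in_x (p n)) [:[:0, 1:], 1:]"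
  let ?R = "\<Sum>k\<le>n. of_nat (n choose k) * in_x (p (n - k)) * in_y (p k)"
  have "poly (coeff ?L i) y = poly (coeff ?R i) y" for y
  proof -
    have "umbral_apply2 (umbral_t i) (umbral_eval y) ?L = umbral_apply2 (umbral_t i) (umbral_eval y) ?R"
      using assms(2) unfolding binomial_type_iff binomial_on_def
      by (simp only: umbral_apply2_translate umbral_apply2_binomial)
    then show ?thesis by (simp only: umbral_apply2_t umbral_apply_eval)
  qed
  then have "\<forall>y. poly (coeff ?L i - coeff ?R i) y = 0" by simp
  then have "coeff ?L i - coeff ?R i = 0"
    using assms(1) unfolding polynomials_are_functions_def by blast
  then show "coeff ?L i = coeff ?R i" by simp
qed

section \<open>Dual sequences\<close>

interpretation poly_module: module "smult :: 'c::comm_ring_1 \<Rightarrow> _"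
  by unfold_locales (simp_all add: smult_add_right smult_add_left)

text \<open>The cosets of \<open>umbral_fil n\<close> are open and form a base of
  neighbourhoods.\<close>

lemma closure_umbral_iff:
  "g \<in> closure S \<longleftrightarrow> (\<forall>n. \<exists>h\<in>S. h - g \<in> umbral_fil n)"
proof
  assume g: "g \<in> closure S"
  show "\<forall>n. \<exists>h\<in>S. h - g \<in> umbral_fil n"
  proof
    fix n
    have "open {h. h - g \<in> umbral_fil n}"
      unfolding open_umbral_def
      by (intro ballI exI[of _ n]) (auto simp: umbral_fil_def minus_umbral.rep_eq)
    moreover have "g \<in> {h. h - g \<in> umbral_fil n}"
      by (simp add: umbral_fil_def zero_umbral.rep_eq)
    ultimately show "\<exists>h\<in>S. h - g \<in> umbral_fil n"
      using g unfolding closure_iff_nhds_not_empty by blast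
  qed
next
  assume *: "\<forall>n. \<exists>h\<in>S. h - g \<in> umbral_fil n"
  show "g \<in> closure S"
    unfolding closure_iff_nhds_not_empty
  proof (intro allI impI)
    fix A V assume "V \<subseteq> A" "open V" "g \<in> V"
    then obtain n where "\<And>h. h - g \<in> umbral_fil n \<Longrightarrow> h \<in> V"
      unfolding open_umbral_def by meson
    with * \<open>V \<subseteq> A\<close> show "S \<inter> A \<noteq> {}" by blast
  qed
qed

text \<open>Vanishing on one filtration term makes \<open>L\<close> continuous into the discrete
  ring, so its zeros pass from a dense span to everything.\<close>

lemma continuous_functional_eq_zero:
  assumes L: "module_hom umbral_scale (*) L"
    and dense: "closure (umbral_algebra.span S) = UNIV"
    and "\<And>x. x \<in> umbral_fil n \<Longrightarrow> L x = 0" and "\<And>x. x \<in> S \<Longrightarrow> L x = 0"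
  shows "L x = 0"
proof -
  interpret L: module_hom umbral_scale "(*)" L by fact
  obtain h where h: "h \<in> umbral_algebra.span S" "h - x \<in> umbral_fil n"
    using dense closure_umbral_iff by blast
  have "L h = 0" using h(1) assms(4) by (rule L.eq_0_on_span[rotated])
  moreover have "L (h - x) = 0" using h(2) assms(3) by simp
  ultimately show ?thesis by (simp add: L.diff)
qed

section \<open>From divided power pseudo-bases to binomial type\<close>

lemma mult_umbral_fil: "f \<in> umbral_fil n \<Longrightarrow> f * g \<in> umbral_fil n"
  by (auto simp: umbral_fil_def times_umbral.rep_eq intro!: sum.neutral)

lemma umbral_apply_fil: "f \<in> umbral_fil n \<Longrightarrow> degree q \<le> n \<Longrightarrow> umbral_apply f q = 0"
  by (simp add: umbral_fil_def umbral_apply_def)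

text \<open>Duality leaves only the index \<open>k = b\<close>, and only for
  \<open>n = a + b\<close>. The convolution becomes the right side of the divided power rule,
  evaluated at \<open>p n\<close>.\<close>

lemma binomial_sum_dual:
  assumes "dual_sequence f p"
  shows "(\<Sum>k\<le>n. of_nat (n choose k) * umbral_apply (f a) (p (n - k)) * umbral_apply (f b) (p k)) =
    umbral_apply (umbral_scale (of_nat ((a + b) choose a)) (f (a + b))) (p n)"
proof -
  have "(\<Sum>k\<le>n. of_nat (n choose k) * umbral_apply (f a) (p (n - k)) * umbral_apply (f b) (p k)) =
      (\<Sum>k\<le>n. if k = b then (if a = n - b then of_nat (n choose b) else 0) else 0)"
    using assms by (intro sum.cong) (auto simp: dual_sequence_def)
  also have "\<dots> = (if n = a + b then of_nat (n choose b) else 0)" by auto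
  also have "\<dots> = umbral_apply (umbral_scale (of_nat ((a + b) choose a)) (f (a + b))) (p n)"
    using assms binomial_symmetric[of a "a + b"]
    by (auto simp: dual_sequence_def umbral_apply_scale_left)
  finally show ?thesis .
qed

lemma formal_binomial_type_if_dual:
  assumes "dual_of_divided_power_pseudo_basis p"
  shows "formal_binomial_type p"
proof -
  obtain f where f: "divided_power_pseudo_basis f" "dual_sequence f p"
    using assms by (auto simp: dual_of_divided_power_pseudo_basis_def)
  then have dense: "closure (umbral_algebra.span (range f)) = UNIV"
    by (simp add: divided_power_pseudo_basis_def pseudo_basis_def)
  have "umbral_apply (g * h) (p n) =
      (\<Sum>k\<le>n. of_nat (n choose k) * umbral_apply g (p (n - k)) * umbral_apply h (p k))" for g h n
  proof -
    \<comment> \<open>The defect of the identity, bilinear in \<open>g\<close> and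
      \<open>h\<close>.\<close>
    define E where "E g h = umbral_apply (g * h) (p n) -
      (\<Sum>k\<le>n. of_nat (n choose k) * umbral_apply g (p (n - k)) * umbral_apply h (p k))" for g h
    have scale_mult: "umbral_scale c x * y = umbral_scale c (x * y)"
      "x * umbral_scale c y = umbral_scale c (x * y)" for c and x y :: "'a umbral"
      by (simp_all flip: umbral_algebra.scale_mult_left umbral_algebra.scale_mult_right)
    have add: "E (x + y) h = E x h + E y h" "E g (x + y) = E g x + E g y" for g h x y
      unfolding E_def distrib_left distrib_right umbral_apply_add_left sum.distrib by simp_all
    have scale: "E (umbral_scale c x) h = c * E x h" "E g (umbral_scale c x) = c * E g x" for c g h x
      unfolding E_def scale_mult umbral_apply_scale_left right_diff_distrib sum_distrib_left
      by (simp_all add: mult.assoc mult.left_commute)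
    have lin1: "module_hom umbral_scale (*) (\<lambda>g. E g h)" for h
      by (intro module_homI module_self umbral_algebra.module_axioms add scale)
    have lin2: "module_hom umbral_scale (*) (E g)" for g
      by (intro module_homI module_self umbral_algebra.module_axioms add scale)
    \<comment> \<open>A bound for the degrees of \<open>p 0\<close> up to \<open>p n\<close>:
      coefficients beyond \<open>N\<close> in either argument do not affect
      \<open>E\<close>.\<close>
    define N where "N = Max ((\<lambda>k. degree (p k)) ` {..n})"
    have N: "degree (p k) \<le> N" if "k \<le> n" for k
      unfolding N_def using that by (intro Max_ge) auto
    have van1: "E x h = 0" if "x \<in> umbral_fil N" for x h
      using that by (simp add: E_def umbral_apply_fil[OF _ N] mult_umbral_fil)
    have van2: "E g x = 0" if "x \<in> umbral_fil N" for x g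
      using that mult_umbral_fil[OF that, of g]
      by (simp add: E_def umbral_apply_fil[OF _ N] mult.commute[of g])
    have E_basis: "E (f a) (f b) = 0" for a b
      using f(1) unfolding E_def binomial_sum_dual[OF f(2)]
      by (simp add: divided_power_pseudo_basis_def)
    \<comment> \<open>Density in the first argument, with \<open>f b\<close> held fixed, precedes
      density in the second.\<close>
    have E_right: "E g (f b) = 0" for g b
      by (rule continuous_functional_eq_zero[OF lin1 dense, where n = N]) (auto simp: E_basis intro: van1)
    have "E g h = 0"
      by (rule continuous_functional_eq_zero[OF lin2 dense, where n = N]) (auto simp: E_right intro: van2)
    then show ?thesis by (simp add: E_def)
  qed
  then show ?thesis by (simp add: formal_binomial_type_iff binomial_on_def)
qed

section \<open>From polynomial bases to dual pseudo-bases\<close>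

lemma dual_sequence_exists:
  fixes p :: "nat \<Rightarrow> 'c::comm_ring_1 poly"
  assumes "polynomial_basis p"
  shows "\<exists>f. dual_sequence f p"
proof -
  have inj: "inj p" and ind: "poly_module.independent (range p)" and span: "poly_module.span (range p) = UNIV"
    using assms by (auto simp: polynomial_basis_def)
  let ?r = "poly_module.representation (range p)"
  \<comment> \<open>The \<open>m\<close>-th coordinate functional of the basis, given by its values
    on monomials.\<close>
  define f where "f m = Abs_umbral (\<lambda>k. ?r (monom 1 k) (p m))" for m
  have "umbral_apply (f m) q = ?r q (p m)" for m q
  proof (induction q rule: poly_monom_induct)
    case (1 c n)
    then show ?case
      using poly_module.representation_scale[OF ind, of "monom 1 n" c]
      by (simp add: umbral_apply_monom f_def Abs_umbral_inverse span smult_monom mult.commute)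
  next
    case (2 q r)
    then show ?case
      by (simp add: umbral_apply_add_right poly_module.representation_add[OF ind] span)
  qed
  then have "dual_sequence f p"
    unfolding dual_sequence_def
    by (simp add: poly_module.representation_basis[OF ind] inj_eq[OF inj])
  then show ?thesis by blast
qed

text \<open>Holding for all large \<open>n\<close> lets finitely many polynomials share one
  truncation.\<close>

lemma dual_expansion:
  assumes "poly_module.span (range p) = UNIV" and "dual_sequence f p"
  shows "\<exists>N. \<forall>n\<ge>N. (\<Sum>i<n. smult (umbral_apply (f i) q) (p i)) = q"
proof -
  have "q \<in> poly_module.span (range p)" by (simp add: assms(1))
  then show ?thesis
  proof (induction q rule: poly_module.span_induct_alt)
    case base
    show ?case by simp
  next
    case (step c x q)
    then obtain m N where m: "x = p m" and N: "\<forall>n\<ge>N. (\<Sum>i<n. smult (umbral_apply (f i) q) (p i)) = q"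
      by auto
    show ?case
    proof (intro exI[of _ "max N (Suc m)"] allI impI)
      fix n assume n: "max N (Suc m) \<le> n"
      have "(\<Sum>i<n. smult (umbral_apply (f i) (smult c x + q)) (p i)) =
          (\<Sum>i<n. if i = m then smult c (p m) else 0) + (\<Sum>i<n. smult (umbral_apply (f i) q) (p i))"
        unfolding sum.distrib[symmetric] using assms(2)
        by (intro sum.cong)
          (auto simp: m umbral_apply_add_right umbral_apply_smult smult_add_left dual_sequence_def)
      then show "(\<Sum>i<n. smult (umbral_apply (f i) (smult c x + q)) (p i)) = smult c x + q"
        using n N by (simp add: m)
    qed
  qed
qed

lemma umbral_eq_on_spanI:
  assumes "poly_module.span (range p) = UNIV" and "\<And>n. umbral_apply f (p n) = umbral_apply g (p n)"
  shows "f = g"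
proof (rule umbral_eq_apply_monomI)
  fix k
  have "monom 1 k \<in> poly_module.span (range p)" by (simp add: assms(1))
  then show "umbral_apply f (monom 1 k) = umbral_apply g (monom 1 k)"
    by (induction rule: poly_module.span_induct_alt)
      (auto simp: umbral_apply_add_right umbral_apply_smult assms(2))
qed

lemma pseudo_basis_dual:
  fixes f :: "nat \<Rightarrow> 'c::comm_ring_1 umbral"
  assumes span: "poly_module.span (range p) = UNIV" and dual: "dual_sequence f p"
  shows "pseudo_basis f"
  unfolding pseudo_basis_def
proof (intro conjI)
  have dual: "umbral_apply (f m) (p n) = (if m = n then 1 else 0)" for m n
    using dual by (simp add: dual_sequence_def)
  show inj: "inj f"
    by (rule injI) (metis dual zero_neq_one)
  show "umbral_algebra.independent (range f)"
    unfolding umbral_algebra.independent_explicit_module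
  proof (intro allI impI)
    fix t and u :: "'c umbral \<Rightarrow> 'c" and v
    assume t: "finite t" "t \<subseteq> range f" "(\<Sum>v\<in>t. umbral_scale (u v) v) = 0" "v \<in> t"
    then obtain n where n: "v = f n" by auto
    \<comment> \<open>Evaluating the relation at \<open>p n\<close> isolates the coefficient of
      \<open>f n\<close>.\<close>
    have "0 = umbral_apply (\<Sum>v\<in>t. umbral_scale (u v) v) (p n)"
      using umbral_apply_scale_left[of 0 0] by (simp add: t(3))
    also have "\<dots> = (\<Sum>w\<in>t. u w * umbral_apply w (p n))"
      by (simp add: umbral_apply_sum_left umbral_apply_scale_left)
    also have "\<dots> = (\<Sum>w\<in>t. if w = v then u v else 0)"
      using t(2) by (intro sum.cong) (auto simp: n dual inj_eq[OF inj])
    also have "\<dots> = u v" using t by simp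
    finally show "u v = 0" by simp
  qed
  show "closure (umbral_algebra.span (range f)) = UNIV"
  proof -
    have "\<exists>h\<in>umbral_algebra.span (range f). h - g \<in> umbral_fil n" for g n
    proof -
      have "\<forall>k. \<exists>N. \<forall>m\<ge>N. (\<Sum>i<m. smult (umbral_apply (f i) (monom 1 k)) (p i)) = monom 1 k"
        using dual_expansion[OF assms] by blast
      from choice[OF this] obtain N where
        N: "\<forall>k. \<forall>m\<ge>N k. (\<Sum>i<m. smult (umbral_apply (f i) (monom 1 k)) (p i)) = monom 1 k" ..
      \<comment> \<open>By \<open>M\<close> the expansions of all monomials of degree at most
        \<open>n\<close> are complete.\<close>
      define M where "M = Max (N ` {..n})"
      \<comment> \<open>The expansion of \<open>g\<close> along the \<open>f i\<close>, whose
        coefficients are the values of \<open>g\<close> on the \<open>p i\<close>, cut off at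
        \<open>M\<close>.\<close>
      define h where "h = (\<Sum>i<M. umbral_scale (umbral_apply g (p i)) (f i))"
      have "ucoeff h k = ucoeff g k" if "k \<le> n" for k
      proof -
        have "N k \<le> M" unfolding M_def using that by (intro Max_ge) auto
        have sum: "umbral_apply g (sum q A) = (\<Sum>i\<in>A. umbral_apply g (q i))" for q and A :: "nat set"
          by (induction A rule: infinite_finite_induct) (simp_all add: umbral_apply_add_right)
        have "ucoeff h k = umbral_apply h (monom 1 k)" by (simp add: umbral_apply_monom)
        also have "\<dots> = (\<Sum>i<M. umbral_apply g (p i) * umbral_apply (f i) (monom 1 k))"
          by (simp add: h_def umbral_apply_sum_left umbral_apply_scale_left)
        also have "\<dots> = umbral_apply g (\<Sum>i<M. smult (umbral_apply (f i) (monom 1 k)) (p i))"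
          by (simp add: sum umbral_apply_smult mult.commute)
        also have "\<dots> = ucoeff g k"
          unfolding N[rule_format, OF \<open>N k \<le> M\<close>] by (simp add: umbral_apply_monom)
        finally show ?thesis .
      qed
      then have "h - g \<in> umbral_fil n" by (simp add: umbral_fil_def minus_umbral.rep_eq)
      moreover have "h \<in> umbral_algebra.span (range f)"
        unfolding h_def by (intro umbral_algebra.span_sum umbral_algebra.span_scale umbral_algebra.span_base) auto
      ultimately show ?thesis by blast
    qed
    then show ?thesis using closure_umbral_iff by blast
  qed
qed

text \<open>A functional is determined by its values on the \<open>p n\<close>; there the binomial
  identity and \<open>binomial_sum_dual\<close> give both sides of the divided power rule the same
  value.\<close>

lemma dual_if_formal_binomial_type:
  assumes "polynomial_basis p" and "formal_binomial_type p"
  shows "dual_of_divided_power_pseudo_basis p"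
proof -
  have span: "poly_module.span (range p) = UNIV"
    using assms(1) by (simp add: polynomial_basis_def)
  obtain f where f: "dual_sequence f p"
    using dual_sequence_exists[OF assms(1)] by blast
  have "f m * f n = umbral_scale (of_nat ((m + n) choose m)) (f (m + n))" for m n
    by (rule umbral_eq_on_spanI[OF span])
      (use assms(2) in \<open>simp add: formal_binomial_type_iff binomial_on_def binomial_sum_dual[OF f]\<close>)
  then have "divided_power_pseudo_basis f"
    using pseudo_basis_dual[OF span f] by (simp add: divided_power_pseudo_basis_def)
  with f show ?thesis
    by (auto simp: dual_of_divided_power_pseudo_basis_def)
qed

text \<open>The zero sequence satisfies the binomial identity but has no dual sequence, hence the
  assumption \<open>polynomial_basis p\<close> in the equivalences.\<close>

theorem theorem2p8:
  fixes p :: "nat \<Rightarrow> 'c::comm_ring_1 poly"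
  shows
    "(free_complete_baxter_algebra TYPE('r::ring_1) (0 :: 'c) (*)
        umbral_scale umbral_shift umbral_const \<and>
      free_baxter_algebra TYPE('r) (0 :: 'c) (*)
        fin_umbral_scale fin_umbral_shift fin_umbral_const)
     \<and>
     ((polynomial_basis p \<longrightarrow>
        (formal_binomial_type p \<longleftrightarrow> dual_of_divided_power_pseudo_basis p)) \<and>
      (polynomial_basis p \<and> polynomials_are_functions TYPE('c) \<longrightarrow>
        (binomial_type p \<longleftrightarrow> dual_of_divided_power_pseudo_basis p)) \<and>
      (dual_of_divided_power_pseudo_basis p \<longrightarrow> formal_binomial_type p \<and> binomial_type p))"
  using free_complete_baxter_algebra_umbral free_baxter_algebra_fin_umbral
    dual_if_formal_binomial_type formal_binomial_type_if_dual
    binomial_type_if_formal formal_binomial_type_if_binomial_type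
  by blast

end
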